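(* Let $C$ be the set of rational Cauchy sequences with the relations $\sim$, $<$ and $\lesssim$ defined in the context. Let $B\subset C$ be a nonempty set for which there is some $(a_n)\in C$ such that $(b_n)\lesssim(a_n)$ for every $(b_n)\in B$. Then $B$ has a least upper bound, that is, there exists a sequence $(a_n')\in C$, unique up to $\sim$, such that (i) $(b_n)\lesssim(a_n')$ for every $(b_n)\in B$, and (ii) for every $(c_n)\in C$ with $(c_n)<(a_n')$ there is a $(b_n)\in B$ with $(c_n)<(b_n)$.
   Context: Here $\mathbb{N}=\{1,2,3,\dots\}$, and $k,m,n,n_0$ range over $\mathbb{N}$. A sequence $(a_n)=(a_n)_{n\in\mathbb{N}}$ in $\mathbb{Q}$ is Cauchy if $\forall k\,\exists n_0\,(m,n\ge n_0\Rightarrow |a_m-a_n|\le 1/k)$. Let $C$ be the set of all Cauchy sequences in $\mathbb{Q}$ (no quotient is taken). On $C$ define the equivalence relation $(a_n)\sim(b_n)\iff \forall k\,\exists n_0\,(n\ge n_0\Rightarrow |a_n-b_n|\le 1/k)$ and the relation $(a_n)<(b_n)\iff \exists k\,\exists n_0\,(n\ge n_0\Rightarrow a_n<b_n-1/k)$. The notation $(a_n)\lesssim(b_n)$ means that $(a_n)<(b_n)$ or $(a_n)\sim(b_n)$. "Unique up to $\sim$" means that any two sequences in $C$ satisfying both (i) and (ii) are related by $\sim$. *)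

theory Defs
  imports Complex_Main
begin

text \<open>
  Sequences are indexed by the positive integers: all indices below are at least 1,
  so the value of a function at 0 is never inspected.
\<close>

definition cauchy_seqs :: "(nat \<Rightarrow> rat) set" where
  "cauchy_seqs = {a. \<forall>k\<ge>1. \<exists>n0\<ge>1. \<forall>m\<ge>n0. \<forall>n\<ge>n0. \<bar>a m - a n\<bar> \<le> 1 / of_nat k}"

definition seq_equiv :: "(nat \<Rightarrow> rat) \<Rightarrow> (nat \<Rightarrow> rat) \<Rightarrow> bool" (infix "\<sim>" 50) where
  "a \<sim> b \<longleftrightarrow> (\<forall>k\<ge>1. \<exists>n0\<ge>1. \<forall>n\<ge>n0. \<bar>a n - b n\<bar> \<le> 1 / of_nat k)"

definition seq_less :: "(nat \<Rightarrow> rat) \<Rightarrow> (nat \<Rightarrow> rat) \<Rightarrow> bool" (infix "\<prec>" 50) where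
  "a \<prec> b \<longleftrightarrow> (\<exists>k\<ge>1. \<exists>n0\<ge>1. \<forall>n\<ge>n0. a n < b n - 1 / of_nat k)"

definition seq_lesssim :: "(nat \<Rightarrow> rat) \<Rightarrow> (nat \<Rightarrow> rat) \<Rightarrow> bool" (infix "\<lesssim>" 50) where
  "a \<lesssim> b \<longleftrightarrow> a \<prec> b \<or> a \<sim> b"

definition is_seq_lub :: "(nat \<Rightarrow> rat) set \<Rightarrow> (nat \<Rightarrow> rat) \<Rightarrow> bool" where
  "is_seq_lub B a \<longleftrightarrow>
     (\<forall>b\<in>B. b \<lesssim> a) \<and>
     (\<forall>c\<in>cauchy_seqs. c \<prec> a \<longrightarrow> (\<exists>b\<in>B. c \<prec> b))"

end

theory Submission
  imports Defs
begin

text \<open>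
  Sending a rational Cauchy sequence to its real limit maps \<open>C\<close> onto the reals and turns
  \<open>\<sim>\<close>, \<open>\<prec>\<close>, \<open>\<lesssim>\<close> into \<open>=\<close>, \<open><\<close>, \<open>\<le>\<close>. Under this map a least upper bound of \<open>B\<close> is
  exactly a sequence whose limit is the supremum of the limits of the members of \<open>B\<close>.
\<close>

lemma ex_inverse_nat_less:
  fixes e :: real
  assumes "0 < e"
  obtains k :: nat where "k \<ge> 1" "1 / real k < e"
  using real_arch_inverse[of e] assms
  by (metis One_nat_def Suc_leI inverse_eq_divide neq0_conv)

lemma all_pos_iff_all_inverse_nat:
  fixes P Q :: "real \<Rightarrow> bool"
  assumes weaken: "\<And>e. P e \<Longrightarrow> Q e" and strengthen: "\<And>d e. d < e \<Longrightarrow> Q d \<Longrightarrow> P e"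
  shows "(\<forall>e>0. P e) \<longleftrightarrow> (\<forall>k::nat\<ge>1. Q (1 / real k))"
proof
  assume "\<forall>e>0. P e"
  then show "\<forall>k::nat\<ge>1. Q (1 / real k)"
    by (simp add: weaken)
next
  assume Q: "\<forall>k::nat\<ge>1. Q (1 / real k)"
  show "\<forall>e>0. P e"
  proof (intro allI impI)
    fix e :: real
    assume "0 < e"
    then obtain k :: nat where "k \<ge> 1" "1 / real k < e"
      by (rule ex_inverse_nat_less)
    with Q strengthen show "P e" by blast
  qed
qed

lemma tendsto_iff_dist_le_inverse_nat:
  fixes f :: "'a \<Rightarrow> 'b::metric_space"
  shows "(f \<longlongrightarrow> l) F \<longleftrightarrow> (\<forall>k::nat\<ge>1. \<forall>\<^sub>F x in F. dist (f x) l \<le> 1 / real k)"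
  unfolding tendsto_iff
  by (rule all_pos_iff_all_inverse_nat) (auto elim: eventually_mono)

lemma Cauchy_iff_dist_le_inverse_nat:
  fixes X :: "nat \<Rightarrow> 'a::metric_space"
  shows "Cauchy X \<longleftrightarrow> (\<forall>k::nat\<ge>1. \<exists>N. \<forall>m\<ge>N. \<forall>n\<ge>N. dist (X m) (X n) \<le> 1 / real k)"
  unfolding Cauchy_def
  by (rule all_pos_iff_all_inverse_nat) (meson less_imp_le, meson le_less_trans)

lemma ex_ge_iff_ex:
  fixes P :: "'a::linorder \<Rightarrow> bool"
  assumes "\<And>m n. m \<le> n \<Longrightarrow> P m \<Longrightarrow> P n"
  shows "(\<exists>n\<ge>c. P n) \<longleftrightarrow> (\<exists>n. P n)"
  by (metis assms linear)

lemma eventually_sequentially_ge: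
  "eventually P sequentially \<longleftrightarrow> (\<exists>N\<ge>c. \<forall>n\<ge>N. P n)"
  unfolding eventually_sequentially by (rule ex_ge_iff_ex[symmetric]) auto

lemma ex_rat_seq_tendsto:
  fixes x :: real
  obtains a where "(\<lambda>n. real_of_rat (a n)) \<longlonglongrightarrow> x"
proof -
  have "\<exists>q. x < real_of_rat q \<and> real_of_rat q < x + inverse (real (Suc n))" for n
    by (rule of_rat_dense) simp
  then obtain a
    where a: "\<And>n. x < real_of_rat (a n) \<and> real_of_rat (a n) < x + inverse (real (Suc n))"
    by metis
  have "(\<lambda>n. real_of_rat (a n)) \<longlonglongrightarrow> x"
  proof (rule tendsto_sandwich)
    show "\<forall>\<^sub>F n in sequentially. x \<le> real_of_rat (a n)"
      and "\<forall>\<^sub>F n in sequentially. real_of_rat (a n) \<le> x + inverse (real (Suc n))"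
      using a by (auto intro!: always_eventually less_imp_le simp del: of_nat_Suc)
  qed (rule tendsto_const LIMSEQ_inverse_real_of_nat_add)+
  then show thesis by (rule that)
qed

lemma eq_cSup_iff:
  fixes x :: "'a::conditionally_complete_linorder"
  assumes "A \<noteq> {}" and "bdd_above A"
  shows "x = Sup A \<longleftrightarrow> (\<forall>y\<in>A. y \<le> x) \<and> (\<forall>z<x. \<exists>y\<in>A. z < y)"
proof -
  have "x = Sup A \<longleftrightarrow> Sup A \<le> x \<and> (\<forall>z<x. z < Sup A)"
    by (meson less_le_trans linorder_not_less order.antisym order.refl)
  then show ?thesis
    using assms by (simp add: cSup_le_iff less_cSup_iff)
qed

lemma rat_abs_diff_le_inverse_nat_iff:
  "\<bar>p - q\<bar> \<le> 1 / of_nat k \<longleftrightarrow>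
    \<bar>of_rat p - of_rat q :: 'a::linordered_field\<bar> \<le> 1 / of_nat k"
  by (simp add: of_rat_diff of_rat_divide flip: of_rat_less_eq[where 'a = 'a] abs_of_rat)

lemma rat_less_diff_inverse_nat_iff:
  "p < q - 1 / of_nat k \<longleftrightarrow> (of_rat p :: 'a::linordered_field) < of_rat q - 1 / of_nat k"
  by (simp add: of_rat_diff of_rat_divide flip: of_rat_less[where 'a = 'a])

lemma cauchy_seqs_iff_Cauchy:
  "a \<in> cauchy_seqs \<longleftrightarrow> Cauchy (\<lambda>n. real_of_rat (a n))"
proof -
  have "(\<exists>N\<ge>1. \<forall>m\<ge>N. \<forall>n\<ge>N. \<bar>a m - a n\<bar> \<le> 1 / of_nat k) \<longleftrightarrow>
      (\<exists>N. \<forall>m\<ge>N. \<forall>n\<ge>N. \<bar>a m - a n\<bar> \<le> 1 / of_nat k)" for k :: nat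
    by (rule ex_ge_iff_ex) auto
  then show ?thesis
    by (simp add: cauchy_seqs_def Cauchy_iff_dist_le_inverse_nat dist_real_def
        rat_abs_diff_le_inverse_nat_iff[where 'a = real])
qed

lemma seq_equiv_iff_diff_tendsto_zero:
  "a \<sim> b \<longleftrightarrow> (\<lambda>n. real_of_rat (a n) - real_of_rat (b n)) \<longlonglongrightarrow> 0"
  by (simp add: seq_equiv_def tendsto_iff_dist_le_inverse_nat
      rat_abs_diff_le_inverse_nat_iff[where 'a = real] flip: eventually_sequentially_ge)

lemma seq_less_iff_eventually_less:
  "a \<prec> b \<longleftrightarrow>
    (\<exists>k::nat\<ge>1. \<forall>\<^sub>F n in sequentially. real_of_rat (a n) < real_of_rat (b n) - 1 / real k)"
  by (simp add: seq_less_def rat_less_diff_inverse_nat_iff[where 'a = real]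
      flip: eventually_sequentially_ge)

definition real_lim :: "(nat \<Rightarrow> rat) \<Rightarrow> real" where
  "real_lim a = lim (\<lambda>n. real_of_rat (a n))"

lemma tendsto_real_lim:
  assumes "a \<in> cauchy_seqs"
  shows "(\<lambda>n. real_of_rat (a n)) \<longlonglongrightarrow> real_lim a"
  using assms
  by (simp add: cauchy_seqs_iff_Cauchy Cauchy_convergent_iff convergent_LIMSEQ_iff real_lim_def)

lemma real_lim_image_cauchy_seqs: "real_lim ` cauchy_seqs = UNIV"
proof -
  have "x \<in> real_lim ` cauchy_seqs" for x
  proof -
    obtain a where a: "(\<lambda>n. real_of_rat (a n)) \<longlonglongrightarrow> x"
      by (rule ex_rat_seq_tendsto)
    then have "a \<in> cauchy_seqs" and "x = real_lim a"
      by (auto simp: cauchy_seqs_iff_Cauchy real_lim_def limI intro: LIMSEQ_imp_Cauchy)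
    then show ?thesis by blast
  qed
  then show ?thesis by blast
qed

lemma seq_equiv_iff_real_lim_eq:
  assumes "a \<in> cauchy_seqs" and "b \<in> cauchy_seqs"
  shows "a \<sim> b \<longleftrightarrow> real_lim a = real_lim b"
proof -
  have "(\<lambda>n. real_of_rat (a n) - real_of_rat (b n)) \<longlonglongrightarrow> real_lim a - real_lim b"
    by (intro tendsto_diff tendsto_real_lim assms)
  then show ?thesis
    unfolding seq_equiv_iff_diff_tendsto_zero by (auto dest: LIMSEQ_unique)
qed

lemma seq_less_iff_real_lim_less:
  assumes a: "a \<in> cauchy_seqs" and b: "b \<in> cauchy_seqs"
  shows "a \<prec> b \<longleftrightarrow> real_lim a < real_lim b"
proof
  assume "a \<prec> b"
  then obtain k :: nat where "k \<ge> 1"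
    and less: "\<forall>\<^sub>F n in sequentially. real_of_rat (a n) < real_of_rat (b n) - 1 / real k"
    unfolding seq_less_iff_eventually_less by blast
  have "(\<lambda>n. real_of_rat (b n) - 1 / real k) \<longlonglongrightarrow> real_lim b - 1 / real k"
    by (intro tendsto_intros tendsto_real_lim b)
  then have "real_lim a \<le> real_lim b - 1 / real k"
    using tendsto_real_lim[OF a] eventually_mono[OF less less_imp_le]
    by (rule tendsto_le[OF sequentially_bot])
  also have "\<dots> < real_lim b"
    using \<open>k \<ge> 1\<close> by simp
  finally show "real_lim a < real_lim b" .
next
  assume "real_lim a < real_lim b"
  then obtain k :: nat where "k \<ge> 1" and gap: "1 / real k < real_lim b - real_lim a"
    using ex_inverse_nat_less[of "real_lim b - real_lim a"] by auto
  have "(\<lambda>n. real_of_rat (b n) - real_of_rat (a n)) \<longlonglongrightarrow> real_lim b - real_lim a"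
    by (intro tendsto_diff tendsto_real_lim a b)
  then have "\<forall>\<^sub>F n in sequentially. 1 / real k < real_of_rat (b n) - real_of_rat (a n)"
    using gap by (rule order_tendstoD)
  then have "\<forall>\<^sub>F n in sequentially. real_of_rat (a n) < real_of_rat (b n) - 1 / real k"
    by (rule eventually_mono) linarith
  with \<open>k \<ge> 1\<close> show "a \<prec> b"
    unfolding seq_less_iff_eventually_less by blast
qed

lemma seq_lesssim_iff_real_lim_le:
  assumes "a \<in> cauchy_seqs" and "b \<in> cauchy_seqs"
  shows "a \<lesssim> b \<longleftrightarrow> real_lim a \<le> real_lim b"
  using assms
  by (auto simp: seq_lesssim_def seq_less_iff_real_lim_less seq_equiv_iff_real_lim_eq)

lemma bdd_above_real_lim_image_iff:
  assumes "B \<subseteq> cauchy_seqs"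
  shows "bdd_above (real_lim ` B) \<longleftrightarrow> (\<exists>a\<in>cauchy_seqs. \<forall>b\<in>B. b \<lesssim> a)"
proof -
  have "bdd_above (real_lim ` B) \<longleftrightarrow> (\<exists>u\<in>real_lim ` cauchy_seqs. \<forall>b\<in>B. real_lim b \<le> u)"
    by (simp add: bdd_above_def real_lim_image_cauchy_seqs)
  also have "\<dots> \<longleftrightarrow> (\<exists>a\<in>cauchy_seqs. \<forall>b\<in>B. b \<lesssim> a)"
    using assms by (auto simp: seq_lesssim_iff_real_lim_le subset_iff)
  finally show ?thesis .
qed

lemma is_seq_lub_iff_real_lim_eq_Sup:
  assumes B: "B \<subseteq> cauchy_seqs" "B \<noteq> {}" "bdd_above (real_lim ` B)" and a: "a \<in> cauchy_seqs"
  shows "is_seq_lub B a \<longleftrightarrow> real_lim a = Sup (real_lim ` B)"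
proof -
  have upper: "(\<forall>b\<in>B. b \<lesssim> a) \<longleftrightarrow> (\<forall>y\<in>real_lim ` B. y \<le> real_lim a)"
    using B(1) a by (auto simp: seq_lesssim_iff_real_lim_le subset_iff)
  have "(\<forall>c\<in>cauchy_seqs. c \<prec> a \<longrightarrow> (\<exists>b\<in>B. c \<prec> b)) \<longleftrightarrow>
      (\<forall>z\<in>real_lim ` cauchy_seqs. z < real_lim a \<longrightarrow> (\<exists>y\<in>real_lim ` B. z < y))"
    using B(1) a by (auto simp: seq_less_iff_real_lim_less subset_iff)
  then have approximable: "(\<forall>c\<in>cauchy_seqs. c \<prec> a \<longrightarrow> (\<exists>b\<in>B. c \<prec> b)) \<longleftrightarrow>
      (\<forall>z<real_lim a. \<exists>y\<in>real_lim ` B. z < y)"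
    by (simp add: real_lim_image_cauchy_seqs)
  show ?thesis
    unfolding is_seq_lub_def upper approximable
    by (rule eq_cSup_iff[symmetric]) (use B in auto)
qed

theorem theorem3p5:
  fixes B :: "(nat \<Rightarrow> rat) set"
  assumes "B \<subseteq> cauchy_seqs"
    and "B \<noteq> {}"
    and "\<exists>a\<in>cauchy_seqs. \<forall>b\<in>B. b \<lesssim> a"
  shows "(\<exists>a'\<in>cauchy_seqs. is_seq_lub B a') \<and>
         (\<forall>a'\<in>cauchy_seqs. \<forall>a''\<in>cauchy_seqs.
            is_seq_lub B a' \<longrightarrow> is_seq_lub B a'' \<longrightarrow> a' \<sim> a'')"
proof -
  have "bdd_above (real_lim ` B)"
    using assms(1,3) by (simp add: bdd_above_real_lim_image_iff)
  with assms(1,2)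
  have lub_iff: "is_seq_lub B a \<longleftrightarrow> real_lim a = Sup (real_lim ` B)" if "a \<in> cauchy_seqs" for a
    using that by (rule is_seq_lub_iff_real_lim_eq_Sup)
  have "Sup (real_lim ` B) \<in> real_lim ` cauchy_seqs"
    by (simp add: real_lim_image_cauchy_seqs)
  then have "\<exists>a'\<in>cauchy_seqs. is_seq_lub B a'"
    using lub_iff by auto
  moreover have "a' \<sim> a''"
    if "a' \<in> cauchy_seqs" "a'' \<in> cauchy_seqs" "is_seq_lub B a'" "is_seq_lub B a''" for a' a''
    using that by (simp add: lub_iff seq_equiv_iff_real_lim_eq)
  ultimately show ?thesis by blast
qed

end
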